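(* For every type $t$, if $t\uparrow_\bot$ holds, then $\llbracket t\rrbracket\neq\emptyset$.
   Context: **Types.** Fix sets of class names $c$ and field names $f$. Types are the finite or infinite terms coinductively defined by $t ::= \mathit{int} \mid \mathit{obj}(c,[f_1{:}t_1,\ldots,f_n{:}t_n]) \mid t_1\vee t_2$. In an object type the fields are finitely many ($n\ge 0$) and distinct, and their order is immaterial. **Values.** Values are the finite or infinite terms coinductively defined by $v ::= i \mid \mathit{obj}(c,[f_1\mapsto v_1,\ldots,f_n\mapsto v_n])$ with $i\in\mathbb{Z}$; fields are again finitely many, distinct, and their order is immaterial. **Derivations.** A derivation is a (possibly infinite) tree whose nodes are pairs (judgment, rule label), such that each node together with its children is a valid instance of the labelled rule. A sub-derivation is a subtree rooted at some node. **Membership.** Judgments $v\in t$, with rules (interpreted coinductively): - (int): $i\in\mathit{int}$ for $i\in\mathbb{Z}$ (no premises). - ($\vee$L): from $v\in t_1$ infer $v\in t_1\vee t_2$. - ($\vee$R): from $v\in t_2$ infer $v\in t_1\vee t_2$. - (obj): from $v_1\in t_1,\ldots,v_n\in t_n$ infer $\mathit{obj}(c,[f_1\mapsto v_1,\ldots,f_n\mapsto v_n,\ldots])\in\mathit{obj}(c,[f_1{:}t_1,\ldots,f_n{:}t_n])$, where the final ellipsis in the value stands for zero or more additional fields. A membership derivation is contractive iff it contains no sub-derivation built only with membership rules ($\vee$L) and ($\vee$R). The relation $v\in t$ holds iff there is a contractive (possibly infinite) derivation for it. The interpretation of a type is $\llbracket t\rrbracket=\{v\mid v\in t\text{ holds}\}$.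 **The predicate $t\uparrow_\bot$.** It is defined by the following rules (interpreted coinductively): - ($\uparrow$int): $\mathit{int}\uparrow_\bot$ (no premises). - ($\uparrow\vee$L): from $t_1\uparrow_\bot$ infer $(t_1\vee t_2)\uparrow_\bot$. - ($\uparrow\vee$R): from $t_2\uparrow_\bot$ infer $(t_1\vee t_2)\uparrow_\bot$. - ($\uparrow$obj): from $t_1\uparrow_\bot,\ldots,t_n\uparrow_\bot$ infer $\mathit{obj}(c,[f_1{:}t_1,\ldots,f_n{:}t_n])\uparrow_\bot$. $t\uparrow_\bot$ holds iff there is a (possibly infinite) derivation for it that is contractive, i.e. contains no sub-derivation obtained by applying only rules ($\uparrow\vee$L) and ($\uparrow\vee$R). *)

theory Defs
  imports Main "HOL-Library.Finite_Map"
begin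

text \<open>Class names and field names are the type parameters \<open>'c\<close> and \<open>'f\<close>.
  The fields of an object type or value form a finite map, so they are finitely many,
  pairwise distinct and unordered. Both syntaxes include the infinite terms, with no
  regularity or contractivity requirement.\<close>

codatatype ('c, 'f) ty =
    TInt
  | TObj 'c "('f, ('c, 'f) ty) fmap"
  | TOr "('c, 'f) ty" "('c, 'f) ty"

codatatype ('c, 'f) val =
    VInt int
  | VObj 'c "('f, ('c, 'f) val) fmap"

codatatype ('j, 'r) tree =
  Node (judgement: 'j) (label: 'r) (children: "('j, 'r) tree list")

inductive subtree :: "('j, 'r) tree \<Rightarrow> ('j, 'r) tree \<Rightarrow> bool" where
  subtree_refl: "subtree d d"
| subtree_child: "e \<in> set (children d) \<Longrightarrow> subtree d' e \<Longrightarrow> subtree d' d"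

text \<open>A rule system is given by its valid instances: \<open>R r ps j\<close> states that rule \<open>r\<close>
  infers \<open>j\<close> from the list of premises \<open>ps\<close>.\<close>

definition derivation :: "('r \<Rightarrow> 'j list \<Rightarrow> 'j \<Rightarrow> bool) \<Rightarrow> ('j, 'r) tree \<Rightarrow> bool" where
  "derivation R d \<longleftrightarrow>
     (\<forall>d'. subtree d' d \<longrightarrow> R (label d') (map judgement (children d')) (judgement d'))"

definition built_only_with :: "'r set \<Rightarrow> ('j, 'r) tree \<Rightarrow> bool" where
  "built_only_with L d \<longleftrightarrow> (\<forall>d'. subtree d' d \<longrightarrow> label d' \<in> L)"

definition contractive :: "'r set \<Rightarrow> ('j, 'r) tree \<Rightarrow> bool" where
  "contractive L d \<longleftrightarrow> (\<nexists>d'. subtree d' d \<and> built_only_with L d')"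

definition derivable :: "('r \<Rightarrow> 'j list \<Rightarrow> 'j \<Rightarrow> bool) \<Rightarrow> 'r set \<Rightarrow> 'j \<Rightarrow> bool" where
  "derivable R L j \<longleftrightarrow> (\<exists>d. derivation R d \<and> contractive L d \<and> judgement d = j)"

datatype mem_rule = Mem_Int | Mem_OrL | Mem_OrR | Mem_Obj

text \<open>The list \<open>fs\<close> in both object rules below is an arbitrary enumeration of the fields of the
  type: the premises are one per field, in any order. The value may have further fields.\<close>

inductive mem_inst ::
  "mem_rule \<Rightarrow> (('c, 'f) val \<times> ('c, 'f) ty) list \<Rightarrow> ('c, 'f) val \<times> ('c, 'f) ty \<Rightarrow> bool" where
  mem_int: "mem_inst Mem_Int [] (VInt i, TInt)"
| mem_orL: "mem_inst Mem_OrL [(v, t1)] (v, TOr t1 t2)"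
| mem_orR: "mem_inst Mem_OrR [(v, t2)] (v, TOr t1 t2)"
| mem_obj: "distinct fs \<Longrightarrow> set fs = fset (fmdom ts) \<Longrightarrow> fmdom ts |\<subseteq>| fmdom vs \<Longrightarrow>
    mem_inst Mem_Obj (map (\<lambda>f. (the (fmlookup vs f), the (fmlookup ts f))) fs)
      (VObj c vs, TObj c ts)"

definition member :: "('c, 'f) val \<Rightarrow> ('c, 'f) ty \<Rightarrow> bool" where
  "member v t \<longleftrightarrow> derivable mem_inst {Mem_OrL, Mem_OrR} (v, t)"

definition interp :: "('c, 'f) ty \<Rightarrow> ('c, 'f) val set" where
  "interp t = {v. member v t}"

datatype up_rule = Up_Int | Up_OrL | Up_OrR | Up_Obj

inductive up_inst :: "up_rule \<Rightarrow> ('c, 'f) ty list \<Rightarrow> ('c, 'f) ty \<Rightarrow> bool" where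
  up_int: "up_inst Up_Int [] TInt"
| up_orL: "up_inst Up_OrL [t1] (TOr t1 t2)"
| up_orR: "up_inst Up_OrR [t2] (TOr t1 t2)"
| up_obj: "distinct fs \<Longrightarrow> set fs = fset (fmdom ts) \<Longrightarrow>
    up_inst Up_Obj (map (\<lambda>f. the (fmlookup ts f)) fs) (TObj c ts)"

definition up_bot :: "('c, 'f) ty \<Rightarrow> bool" where
  "up_bot t \<longleftrightarrow> derivable up_inst {Up_OrL, Up_OrR} t"

end

(* The value is read off a contractive derivation of the predicate: a union node takes the value
   of its only premise, an object node takes exactly the fields of its type. Decorating every node
   of the derivation with its value yields a membership derivation of the same shape, and
   contractivity is inherited because union rules correspond to union rules. *)

theory Submission
  imports Defs
begin

text \<open>\<open>g\<close> receives the whole subtree and not only its root judgement, because the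
  value attached to a node depends on the derivation below it.\<close>

primcorec decorate :: "(('j, 'r) tree \<Rightarrow> 'k) \<Rightarrow> ('r \<Rightarrow> 's) \<Rightarrow> ('j, 'r) tree \<Rightarrow> ('k, 's) tree" where
  "decorate g h d = Node (g d) (h (label d)) (map (decorate g h) (children d))"

lemma subtree_decorate: "subtree e d \<Longrightarrow> subtree (decorate g h e) (decorate g h d)"
proof (induction rule: subtree.induct)
  case (subtree_refl d)
  show ?case by (rule subtree.subtree_refl)
next
  case (subtree_child e d d')
  then have "decorate g h e \<in> set (children (decorate g h d))" by simp
  then show ?case using subtree_child.IH by (rule subtree.subtree_child)
qed

lemma subtree_decorateE:
  assumes "subtree x (decorate g h d)"
  obtains e where "subtree e d" "x = decorate g h e"
proof -
  have "\<exists>e. subtree e d \<and> x = decorate g h e"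
    using assms
    by (induction x "decorate g h d" arbitrary: d rule: subtree.induct)
      (auto intro: subtree.intros)
  then show thesis using that by blast
qed

lemma derivation_decorate:
  assumes "derivation R d"
    and "\<And>e. R (label e) (map judgement (children e)) (judgement e) \<Longrightarrow>
           S (h (label e)) (map g (children e)) (g e)"
  shows "derivation S (decorate g h d)"
  using assms by (auto simp: derivation_def comp_def elim!: subtree_decorateE)

text \<open>A subtree of the decoration is the decoration of some subtree \<open>e\<close> of
  \<open>d\<close>. If its labels all lie in \<open>M\<close>, those of \<open>e\<close> lie in the
  preimage of \<open>M\<close>, hence in \<open>L\<close>, which contractivity of \<open>d\<close>
  forbids.\<close>

lemma contractive_decorate:
  assumes "contractive L d" "h -` M \<subseteq> L"
  shows "contractive M (decorate g h d)"
proof -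
  have "built_only_with L e" if "built_only_with M (decorate g h e)" for e
    using that assms(2) subtree_decorate[of _ e g h]
    by (fastforce simp: built_only_with_def)
  then show ?thesis
    using assms(1) by (auto simp: contractive_def elim!: subtree_decorateE)
qed

(* On an infinite chain of union nodes the result is unspecified; the equation still holds. *)
partial_function (tailrec) skip_unions :: "('j, up_rule) tree \<Rightarrow> ('j, up_rule) tree" where
  "skip_unions d =
     (if label d \<in> {Up_OrL, Up_OrR} then skip_unions (hd (children d)) else d)"

text \<open>An instance of the object rule does not record which premise belongs to which field;
  \<open>fs\<close> is one assignment that fits the premises \<open>ds\<close>.\<close>

definition enumerates_fields ::
  "('f, ('c, 'f) ty) fmap \<Rightarrow> (('c, 'f) ty, 'r) tree list \<Rightarrow> 'f list \<Rightarrow> bool" where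
  "enumerates_fields ts ds fs \<longleftrightarrow> distinct fs \<and> set fs = fset (fmdom ts) \<and>
     map judgement ds = map (\<lambda>f. the (fmlookup ts f)) fs"

text \<open>Fields of equal type can be swapped, so several enumerations may fit; any fixed choice
  serves.\<close>

definition field_trees ::
  "('f, ('c, 'f) ty) fmap \<Rightarrow> (('c, 'f) ty, 'r) tree list \<Rightarrow> ('f, (('c, 'f) ty, 'r) tree) fmap" where
  "field_trees ts ds = fmap_of_list (zip (SOME fs. enumerates_fields ts ds fs) ds)"

(* The value for TOr is junk: a contractive derivation never reaches that case. *)
primcorec witness :: "(('c, 'f) ty, up_rule) tree \<Rightarrow> ('c, 'f) val" where
  "witness d = (case judgement (skip_unions d) of
     TInt \<Rightarrow> VInt 0
   | TObj c ts \<Rightarrow> VObj c (fmmap witness (field_trees ts (children (skip_unions d))))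
   | TOr _ _ \<Rightarrow> VInt 0)"

lemma witness_TInt:
  "label d = Up_Int \<Longrightarrow> judgement d = TInt \<Longrightarrow> witness d = VInt 0"
  by (subst witness.code, subst skip_unions.simps) simp

lemma witness_TObj:
  "label d = Up_Obj \<Longrightarrow> judgement d = TObj c ts \<Longrightarrow>
     witness d = VObj c (fmmap witness (field_trees ts (children d)))"
  by (subst witness.code, subst (1 2) skip_unions.simps) (simp add: skip_unions.simps)

text \<open>\<open>witness\<close> inspects its argument only through \<open>skip_unions\<close>,
  and one unfolding of that function moves from a union node to its first child.\<close>

lemma witness_union:
  assumes "label d \<in> {Up_OrL, Up_OrR}"
  shows "witness d = witness (hd (children d))"
proof -
  have "skip_unions d = skip_unions (hd (children d))"
    using assms by (subst skip_unions.simps) simp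
  then show ?thesis
    by (simp add: witness.code[of d] witness.code[of "hd (children d)"] cong: ty.case_cong)
qed

text \<open>\<open>fs0\<close> guarantees that the choice inside \<open>field_trees\<close>
  succeeds; the \<open>fs\<close> obtained is the chosen enumeration and may differ from
  \<open>fs0\<close>. It is distinct and as long as \<open>ds\<close>, so looking up its i-th field
  returns the i-th tree.\<close>

lemma field_trees_enumeration:
  assumes "enumerates_fields ts ds fs0"
  obtains fs where "enumerates_fields ts ds fs" "fmdom (field_trees ts ds) = fmdom ts"
    "map (\<lambda>f. the (fmlookup (field_trees ts ds) f)) fs = ds"
proof -
  define fs where "fs = (SOME fs. enumerates_fields ts ds fs)"
  have fs: "enumerates_fields ts ds fs"
    unfolding fs_def using assms by (rule someI)
  then have len: "length fs = length ds"
    unfolding enumerates_fields_def by (metis length_map)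
  have eq: "field_trees ts ds = fmap_of_list (zip fs ds)"
    by (simp add: field_trees_def fs_def)
  have "fset (fmdom (field_trees ts ds)) = fset (fmdom ts)"
    using fs len by (simp add: eq enumerates_fields_def fset_of_list.rep_eq)
  moreover have "map (\<lambda>f. the (fmlookup (field_trees ts ds) f)) fs = ds"
    using fs len
    by (intro nth_equalityI)
      (auto simp: eq enumerates_fields_def fmlookup_of_list map_of_zip_nth)
  ultimately show thesis
    using that fs by (simp add: fset_inject)
qed

fun mem_rule_of :: "up_rule \<Rightarrow> mem_rule" where
  "mem_rule_of Up_Int = Mem_Int"
| "mem_rule_of Up_OrL = Mem_OrL"
| "mem_rule_of Up_OrR = Mem_OrR"
| "mem_rule_of Up_Obj = Mem_Obj"

text \<open>The simulation of a single node, in the form that \<open>derivation_decorate\<close>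
  asks for.\<close>

lemma mem_inst_witness:
  assumes "up_inst (label d) (map judgement (children d)) (judgement d)"
  shows "mem_inst (mem_rule_of (label d)) (map (\<lambda>e. (witness e, judgement e)) (children d))
    (witness d, judgement d)"
  using assms
proof cases
  case up_int
  then show ?thesis by (simp add: witness_TInt mem_inst.intros)
next
  case (up_orL t1 t2)
  then obtain e where "children d = [e]" "judgement e = t1" by auto
  with up_orL show ?thesis by (simp add: witness_union mem_inst.intros)
next
  case (up_orR t2 t1)
  then obtain e where "children d = [e]" "judgement e = t2" by auto
  with up_orR show ?thesis by (simp add: witness_union mem_inst.intros)
next
  case (up_obj fs0 ts c)
  let ?m = "field_trees ts (children d)"
  have "enumerates_fields ts (children d) fs0"
    using up_obj by (simp add: enumerates_fields_def)
  \<comment> \<open>Passing from \<open>fs0\<close> to the chosen enumeration is harmless because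
    \<open>mem_obj\<close> accepts the fields in any order.\<close>
  then obtain fs where fs: "enumerates_fields ts (children d) fs"
    and dom: "fmdom ?m = fmdom ts"
    and ch: "map (\<lambda>f. the (fmlookup ?m f)) fs = children d"
    by (rule field_trees_enumeration)
  have "the (fmlookup (fmmap witness ?m) f) = witness (the (fmlookup ?m f))"
    and "the (fmlookup ts f) = judgement (the (fmlookup ?m f))" if "f \<in> set fs" for f
  proof -
    \<comment> \<open>Inside the domain the lookup succeeds, so \<open>witness\<close> commutes with
      \<open>the\<close>.\<close>
    have "f |\<in>| fmdom ?m"
      using fs dom that by (simp add: enumerates_fields_def)
    then show "the (fmlookup (fmmap witness ?m) f) = witness (the (fmlookup ?m f))"
      by (auto simp: fmlookup_dom_iff)
    have "map judgement (map (\<lambda>f. the (fmlookup ?m f)) fs) = map (\<lambda>f. the (fmlookup ts f)) fs"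
      using fs by (simp only: ch enumerates_fields_def)
    then show "the (fmlookup ts f) = judgement (the (fmlookup ?m f))"
      using that by simp
  qed
  then have "map (\<lambda>f. (the (fmlookup (fmmap witness ?m) f), the (fmlookup ts f))) fs =
      map (\<lambda>e. (witness e, judgement e)) (map (\<lambda>f. the (fmlookup ?m f)) fs)"
    by simp
  moreover have "mem_inst Mem_Obj
      (map (\<lambda>f. (the (fmlookup (fmmap witness ?m) f), the (fmlookup ts f))) fs)
      (VObj c (fmmap witness ?m), TObj c ts)"
    using fs dom by (intro mem_obj) (auto simp: enumerates_fields_def)
  ultimately show ?thesis
    using up_obj by (simp only: ch witness_TObj mem_rule_of.simps)
qed

theorem theorem5p1:
  fixes t :: "('c, 'f) ty"
  assumes "up_bot t"
  shows "interp t \<noteq> {}"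
proof -
  obtain d where d: "derivation up_inst d" "contractive {Up_OrL, Up_OrR} d" "judgement d = t"
    using assms by (auto simp: up_bot_def derivable_def)
  let ?m = "decorate (\<lambda>e. (witness e, judgement e)) mem_rule_of d"
  \<comment> \<open>A union label in the decoration can stem only from a union label in
    \<open>d\<close>; contractivity is transferred in this direction.\<close>
  have "mem_rule_of -` {Mem_OrL, Mem_OrR} \<subseteq> {Up_OrL, Up_OrR}"
    by (auto elim: mem_rule_of.elims)
  with d(2) have "contractive {Mem_OrL, Mem_OrR} ?m"
    by (rule contractive_decorate)
  moreover have "derivation mem_inst ?m"
    using d(1) mem_inst_witness by (rule derivation_decorate)
  ultimately have "member (witness d) t"
    using d(3) by (auto simp: member_def derivable_def intro!: exI[of _ ?m])
  then show ?thesis by (auto simp: interp_def)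
qed

end
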